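(* Let $x_k\in\mathcal D$ and let $B_k:\mathcal E\to\mathcal E$ be a Euclidean-symmetric operator that is positive definite on $\mathrm T_{x_k}\mathcal M_{x_k}$. Then the SQP direction $$d_k=\arg\min_{d\in\mathcal E}\ f(x_k)+\langle d,\nabla_{\mathcal E}f(x_k)\rangle_{\mathcal E}+\tfrac12\langle d,B_kd\rangle_{\mathcal E}\quad\text{subject to}\quad\mathrm Dc(x_k)d+c(x_k)=0$$ is given by $$d_k=-\mathrm{grad}^g_{\mathcal M_{x_k}}f(x_k)-\mathrm Dc(x_k)^{\dagger,g}c(x_k),$$ where the metric $g$ is $$g(\xi,\zeta)=\langle\mathrm{Proj}_{x_k}\xi,B_k\mathrm{Proj}_{x_k}\zeta\rangle_{\mathcal E}+\langle\mathrm{Proj}_{x_k}^\perp\xi,G_N(x_k)\mathrm{Proj}_{x_k}^\perp\zeta\rangle_{\mathcal E},$$ $\mathrm{Proj}_{x_k}$ is the (oblique) projector onto $\mathrm T_{x_k}\mathcal M_{x_k}$ associated with the decomposition $\mathcal E=\mathrm T_{x_k}\mathcal M_{x_k}\oplus\mathrm N_{x_k}\mathcal M_{x_k}$ with $$\mathrm N_{x_k}\mathcal M_{x_k}=(B_k\mathrm T_{x_k}\mathcal M_{x_k})^{\perp,\mathcal E},$$ $\mathrm{Proj}^\perp_{x_k}=\mathrm{Id}_{\mathcal E}-\mathrm{Proj}_{x_k}$, and $G_N(x_k)$ is any symmetric operator positive definite on $\mathrm N_{x_k}\mathcal M_{x_k}$. In other words, the SQP direction is the landing direction $-\mathrm{grad}^g_{\mathcal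 M_{x}}f(x)-\mathrm Dc(x)^{\dagger,g}H(x)c(x)$ at $x=x_k$ with $H(x_k)=\mathrm{Id}_{\mathcal F}$, the normal space $\mathrm N_{x_k}\mathcal M_{x_k}=(B_k\mathrm T_{x_k}\mathcal M_{x_k})^{\perp,\mathcal E}$, and the tangent metric induced by $B_k$ on $\mathrm T_{x_k}\mathcal M_{x_k}$.
   Context: $\mathcal E,\mathcal F$ are finite-dimensional Euclidean spaces, $m=\dim\mathcal F<\dim\mathcal E$; $f:\mathcal E\to\mathbb R$, $c:\mathcal E\to\mathcal F$ are continuously differentiable; $\mathcal D=\{x:\operatorname{rank}\mathrm Dc(x)=m\}$; $\mathcal M_x=\{y:c(y)=c(x)\}$, $\mathrm T_x\mathcal M_x=\ker\mathrm Dc(x)$. $V^{\perp,\mathcal E}$ is the Euclidean orthogonal complement; $\nabla_{\mathcal E}f$ the Euclidean gradient. $\mathrm{grad}^g_{\mathcal M_x}f(x)$ is the unique vector in $\mathrm T_x\mathcal M_x$ with $g(\mathrm{grad}^g_{\mathcal M_x}f(x),\xi)=\mathrm Df(x)[\xi]$ for all $\xi\in\mathrm T_x\mathcal M_x$. $A^{*,g}$ is defined by $\langle A\xi,y\rangle_{\mathcal F}=g(\xi,A^{*,g}y)$, and $\mathrm Dc(x)^{\dagger,g}=\mathrm Dc(x)^{*,g}(\mathrm Dc(x)\mathrm Dc(x)^{*,g})^{-1}$. *)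

theory Defs
  imports "HOL-Analysis.Analysis"
begin

definition cont_diff :: "('e::euclidean_space \<Rightarrow> 'f::euclidean_space) \<Rightarrow> bool" where
  "cont_diff h \<longleftrightarrow>
     (\<exists>h' :: 'e \<Rightarrow> ('e \<Rightarrow>\<^sub>L 'f).
        (\<forall>x. (h has_derivative blinfun_apply (h' x)) (at x)) \<and> continuous_on UNIV h')"

abbreviation Diff :: "('e::euclidean_space \<Rightarrow> 'f::euclidean_space) \<Rightarrow> 'e \<Rightarrow> 'e \<Rightarrow> 'f" where
  "Diff h x \<equiv> frechet_derivative h (at x)"

definition euclidean_gradient :: "('e::euclidean_space \<Rightarrow> real) \<Rightarrow> 'e \<Rightarrow> 'e" where
  "euclidean_gradient f x = (THE v. GDERIV f x :> v)"

definition full_rank_set :: "('e::euclidean_space \<Rightarrow> 'f::euclidean_space) \<Rightarrow> 'e set" where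
  "full_rank_set c = {x. dim (range (Diff c x)) = DIM('f)}"

text \<open>The tangent space at \<open>x\<close> of the level set \<open>{y. c y = c x}\<close>.\<close>

definition tangent_space :: "('e::euclidean_space \<Rightarrow> 'f::euclidean_space) \<Rightarrow> 'e \<Rightarrow> 'e set" where
  "tangent_space c x = {\<xi>. Diff c x \<xi> = 0}"

definition symmetric_operator :: "('e::euclidean_space \<Rightarrow> 'e) \<Rightarrow> bool" where
  "symmetric_operator B \<longleftrightarrow> linear B \<and> (\<forall>\<xi> \<zeta>. B \<xi> \<bullet> \<zeta> = \<xi> \<bullet> B \<zeta>)"

definition pos_def_on :: "'e::euclidean_space set \<Rightarrow> ('e \<Rightarrow> 'e) \<Rightarrow> bool" where
  "pos_def_on S B \<longleftrightarrow> (\<forall>\<xi>\<in>S. \<xi> \<noteq> 0 \<longrightarrow> \<xi> \<bullet> B \<xi> > 0)"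

definition inner_product_form :: "('e::euclidean_space \<Rightarrow> 'e \<Rightarrow> real) \<Rightarrow> bool" where
  "inner_product_form g \<longleftrightarrow>
     bilinear g \<and> (\<forall>\<xi> \<zeta>. g \<xi> \<zeta> = g \<zeta> \<xi>) \<and> (\<forall>\<xi>. \<xi> \<noteq> 0 \<longrightarrow> g \<xi> \<xi> > 0)"

definition direct_decomposition :: "'e::euclidean_space set \<Rightarrow> 'e set \<Rightarrow> bool" where
  "direct_decomposition T N \<longleftrightarrow>
     subspace T \<and> subspace N \<and> T \<inter> N = {0} \<and> (\<forall>\<xi>. \<exists>t\<in>T. \<exists>n\<in>N. \<xi> = t + n)"

text \<open>Projector onto \<open>T\<close> along \<open>N\<close>; meaningful when \<open>direct_decomposition T N\<close> holds.\<close>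

definition oblique_proj :: "'e::euclidean_space set \<Rightarrow> 'e set \<Rightarrow> 'e \<Rightarrow> 'e" where
  "oblique_proj T N \<xi> = (THE t. t \<in> T \<and> \<xi> - t \<in> N)"

text \<open>
  Below, \<open>g\<close> is the value of a metric at the single point under consideration; the gradient,
  the adjoint and the pseudoinverse are meaningful when \<open>inner_product_form g\<close> holds
  (for the pseudoinverse, the operator must also be surjective).
\<close>

definition riemannian_gradient ::
  "('e::euclidean_space \<Rightarrow> 'e \<Rightarrow> real) \<Rightarrow> ('e \<Rightarrow> 'f::euclidean_space) \<Rightarrow> ('e \<Rightarrow> real) \<Rightarrow> 'e \<Rightarrow> 'e" where
  "riemannian_gradient g c f x =
     (THE v. v \<in> tangent_space c x \<and> (\<forall>\<xi>\<in>tangent_space c x. g v \<xi> = Diff f x \<xi>))"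

definition metric_adjoint ::
  "('e::euclidean_space \<Rightarrow> 'e \<Rightarrow> real) \<Rightarrow> ('e \<Rightarrow> 'f::euclidean_space) \<Rightarrow> 'f \<Rightarrow> 'e" where
  "metric_adjoint g A = (THE A'. \<forall>\<xi> y. A \<xi> \<bullet> y = g \<xi> (A' y))"

definition metric_pinv ::
  "('e::euclidean_space \<Rightarrow> 'e \<Rightarrow> real) \<Rightarrow> ('e \<Rightarrow> 'f::euclidean_space) \<Rightarrow> 'f \<Rightarrow> 'e" where
  "metric_pinv g A = metric_adjoint g A \<circ> inv (A \<circ> metric_adjoint g A)"

definition landing_direction ::
  "('e::euclidean_space \<Rightarrow> 'e \<Rightarrow> real) \<Rightarrow> ('e \<Rightarrow> 'f \<Rightarrow> 'f) \<Rightarrow> ('e \<Rightarrow> 'f::euclidean_space)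
     \<Rightarrow> ('e \<Rightarrow> real) \<Rightarrow> 'e \<Rightarrow> 'e" where
  "landing_direction g H c f x =
     - riemannian_gradient g c f x - metric_pinv g (Diff c x) (H x (c x))"

definition sqp_normal_space ::
  "('e::euclidean_space \<Rightarrow> 'f::euclidean_space) \<Rightarrow> ('e \<Rightarrow> 'e) \<Rightarrow> 'e \<Rightarrow> 'e set" where
  "sqp_normal_space c B x = (B ` tangent_space c x)\<^sup>\<bottom>"

definition sqp_proj ::
  "('e::euclidean_space \<Rightarrow> 'f::euclidean_space) \<Rightarrow> ('e \<Rightarrow> 'e) \<Rightarrow> 'e \<Rightarrow> 'e \<Rightarrow> 'e" where
  "sqp_proj c B x = oblique_proj (tangent_space c x) (sqp_normal_space c B x)"

definition sqp_proj_perp ::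
  "('e::euclidean_space \<Rightarrow> 'f::euclidean_space) \<Rightarrow> ('e \<Rightarrow> 'e) \<Rightarrow> 'e \<Rightarrow> 'e \<Rightarrow> 'e" where
  "sqp_proj_perp c B x \<xi> = \<xi> - sqp_proj c B x \<xi>"

definition sqp_metric ::
  "('e::euclidean_space \<Rightarrow> 'f::euclidean_space) \<Rightarrow> ('e \<Rightarrow> 'e) \<Rightarrow> ('e \<Rightarrow> 'e) \<Rightarrow> 'e \<Rightarrow> 'e \<Rightarrow> 'e \<Rightarrow> real" where
  "sqp_metric c B G x \<xi> \<zeta> =
     sqp_proj c B x \<xi> \<bullet> B (sqp_proj c B x \<zeta>) +
     sqp_proj_perp c B x \<xi> \<bullet> G (sqp_proj_perp c B x \<zeta>)"

definition is_sqp_direction ::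
  "('e::euclidean_space \<Rightarrow> real) \<Rightarrow> ('e \<Rightarrow> 'f::euclidean_space) \<Rightarrow> ('e \<Rightarrow> 'e) \<Rightarrow> 'e \<Rightarrow> 'e \<Rightarrow> bool" where
  "is_sqp_direction f c B x d \<longleftrightarrow>
     is_arg_min (\<lambda>d. f x + d \<bullet> euclidean_gradient f x + 1 / 2 * (d \<bullet> B d))
                (\<lambda>d. Diff c x d + c x = 0) d"

end

theory Submission
  imports Defs
begin

text \<open>
  On the affine space \<open>{d. Diff c x d + c x = 0}\<close>, which is a translate of the tangent space \<open>T\<close>,
  the quadratic model is strictly convex, so a feasible \<open>d\<close> with \<open>\<nabla>f + B d \<bottom> T\<close> is its unique
  minimizer. For the proposed direction, feasibility holds because the pseudoinverse is a right
  inverse of \<open>Diff c x\<close>. Stationarity holds because the pseudoinverse takes values in the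
  \<open>g\<close>-orthogonal complement of \<open>T\<close>, which is \<open>(B T)\<^sup>\<bottom>\<close>, and \<open>g\<close> agrees with \<open>B\<close> on \<open>T\<close>.
\<close>

section \<open>Riesz representation on a subspace\<close>

lemma bilinear_riesz_on:
  fixes g :: "'e::euclidean_space \<Rightarrow> 'e \<Rightarrow> real" and \<phi> :: "'e \<Rightarrow> real"
  assumes g: "bilinear g" and S: "subspace S" and \<phi>: "linear \<phi>"
    and pos: "\<And>\<xi>. \<xi> \<in> S \<Longrightarrow> \<xi> \<noteq> 0 \<Longrightarrow> g \<xi> \<xi> > 0"
  shows "\<exists>!v. v \<in> S \<and> (\<forall>\<xi>\<in>S. g \<xi> v = \<phi> \<xi>)"
proof -
  define A where "A \<zeta> = (\<Sum>b\<in>Basis. g b \<zeta> *\<^sub>R b)" for \<zeta>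
  have rep: "\<psi> \<xi> = \<xi> \<bullet> (\<Sum>b\<in>Basis. \<psi> b *\<^sub>R b)" if "linear \<psi>" for \<psi> :: "'e \<Rightarrow> real" and \<xi>
  proof -
    have "\<psi> \<xi> = \<psi> (\<Sum>b\<in>Basis. (\<xi> \<bullet> b) *\<^sub>R b)"
      by (simp add: euclidean_representation)
    also have "\<dots> = \<xi> \<bullet> (\<Sum>b\<in>Basis. \<psi> b *\<^sub>R b)"
      by (simp add: linear_sum[OF that] linear_cmul[OF that] inner_sum_right mult.commute)
    finally show ?thesis .
  qed
  have gA: "g \<xi> \<zeta> = \<xi> \<bullet> A \<zeta>" for \<xi> \<zeta>
    unfolding A_def using g by (intro rep) (simp add: bilinear_def)
  have A: "linear A"
    unfolding A_def
    by (rule linearI)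
      (simp_all add: bilinear_radd[OF g] bilinear_rmul[OF g] scaleR_add_left sum.distrib
        scaleR_sum_right)
  define w where "w = (\<Sum>b\<in>Basis. \<phi> b *\<^sub>R b)"
  have w: "\<phi> \<xi> = \<xi> \<bullet> w" for \<xi>
    unfolding w_def by (rule rep[OF \<phi>])
  have A_S: "subspace (A ` S)"
    by (rule linear_subspace_image[OF A S])
  have "inj_on A S"
  proof (rule inj_onI)
    fix u v assume uv: "u \<in> S" "v \<in> S" "A u = A v"
    then have "g (u - v) (u - v) = 0"
      by (simp add: gA linear_diff[OF A])
    with pos[of "u - v"] uv S show "u = v"
      by (fastforce simp: subspace_diff)
  qed
  then have dim_A: "dim (A ` S) = dim S"
    using S A by (metis dim_image_eq span_eq_iff)
  \<comment> \<open>If \<open>A v\<close> is orthogonal to \<open>S\<close> with \<open>v\<close> in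
    \<open>S\<close>, then \<open>g v v = v \<bullet> A v = 0\<close>, which forces
    \<open>v = 0\<close>.\<close>
  have "A ` S \<inter> S\<^sup>\<bottom> = {0}"
  proof -
    have "v = 0" if "v \<in> S" "A v \<in> S\<^sup>\<bottom>" for v
      using that pos[of v] by (force simp: gA orthogonal_comp_def orthogonal_def)
    then show ?thesis
      using subspace_0[OF A_S] subspace_0[OF subspace_orthogonal_comp[of S]]
        linear_0[OF A] by auto
  qed
  moreover have "dim (S\<^sup>\<bottom>) + dim S = DIM('e)"
    using dim_subspace_orthogonal_to_vectors[OF S subspace_UNIV subset_UNIV]
    by (simp add: orthogonal_comp_def orthogonal_def)
  ultimately have "dim {a + b |a b. a \<in> A ` S \<and> b \<in> S\<^sup>\<bottom>} = DIM('e)"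
    using dim_sums_Int[OF A_S subspace_orthogonal_comp[of S]] dim_A by simp
  then have "span {a + b |a b. a \<in> A ` S \<and> b \<in> S\<^sup>\<bottom>} = UNIV"
    by (simp only: dim_eq_full)
  then have "{a + b |a b. a \<in> A ` S \<and> b \<in> S\<^sup>\<bottom>} = UNIV"
    by (simp only: span_eq_iff[THEN iffD2, OF subspace_sums[OF A_S subspace_orthogonal_comp]])
  then have "w \<in> {a + b |a b. a \<in> A ` S \<and> b \<in> S\<^sup>\<bottom>}"
    by simp
  then obtain v b where v: "v \<in> S" and b: "b \<in> S\<^sup>\<bottom>" and "w = A v + b"
    by blast
  \<comment> \<open>The component \<open>b\<close> of \<open>w\<close> is invisible to vectors of
    \<open>S\<close>, so \<open>v\<close> alone represents \<open>\<phi>\<close> there.\<close>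
  then have "\<forall>\<xi>\<in>S. g \<xi> v = \<phi> \<xi>"
    by (auto simp: gA w inner_add_right orthogonal_comp_def orthogonal_def)
  moreover have "u = v" if "u \<in> S" "\<forall>\<xi>\<in>S. g \<xi> u = \<phi> \<xi>" for u
  proof -
    have "u - v \<in> S"
      using that v S by (simp add: subspace_diff)
    moreover from this have "g (u - v) (u - v) = 0"
      using that \<open>\<forall>\<xi>\<in>S. g \<xi> v = \<phi> \<xi>\<close> by (simp add: bilinear_rsub[OF g])
    ultimately show "u = v"
      using pos[of "u - v"] by fastforce
  qed
  ultimately show ?thesis
    using v by blast
qed

section \<open>Oblique projectors and the B-orthogonal splitting\<close>

lemma oblique_proj_unique:
  assumes "direct_decomposition T N" "t \<in> T" "\<xi> - t \<in> N"
  shows "oblique_proj T N \<xi> = t"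
  unfolding oblique_proj_def
proof (rule the_equality)
  fix s assume s: "s \<in> T \<and> \<xi> - s \<in> N"
  have "s - t \<in> T"
    using assms s by (auto simp: direct_decomposition_def subspace_diff)
  moreover have "(\<xi> - t) - (\<xi> - s) \<in> N"
    using assms s unfolding direct_decomposition_def by (blast intro: subspace_diff)
  ultimately have "s - t \<in> T \<inter> N" by simp
  then show "s = t"
    using assms(1) by (simp only: direct_decomposition_def singleton_iff right_minus_eq)
qed (use assms in blast)

lemma oblique_proj_mem:
  assumes "direct_decomposition T N"
  shows "oblique_proj T N \<xi> \<in> T" "\<xi> - oblique_proj T N \<xi> \<in> N"
proof -
  obtain t n where "t \<in> T" "n \<in> N" "\<xi> = t + n"
    using assms unfolding direct_decomposition_def by blast
  with oblique_proj_unique[OF assms, of t \<xi>]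
  show "oblique_proj T N \<xi> \<in> T" "\<xi> - oblique_proj T N \<xi> \<in> N" by simp_all
qed

lemma linear_oblique_proj:
  assumes "direct_decomposition T N"
  shows "linear (oblique_proj T N)"
proof (rule linearI)
  have sub: "subspace T" "subspace N"
    using assms by (auto simp: direct_decomposition_def)
  note P = oblique_proj_mem[OF assms]
  fix a b :: 'a and r :: real
  have "(a - oblique_proj T N a) + (b - oblique_proj T N b) \<in> N"
    using sub P by (intro subspace_add)
  then show "oblique_proj T N (a + b) = oblique_proj T N a + oblique_proj T N b"
    using sub P
    by (intro oblique_proj_unique[OF assms]) (auto simp: subspace_add algebra_simps)
  have "r *\<^sub>R (a - oblique_proj T N a) \<in> N"
    using sub P by (intro subspace_scale)
  then show "oblique_proj T N (r *\<^sub>R a) = r *\<^sub>R oblique_proj T N a"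
    using sub P
    by (intro oblique_proj_unique[OF assms]) (auto simp: subspace_scale algebra_simps)
qed

lemma bilinear_inner_operator:
  fixes B P :: "'e::euclidean_space \<Rightarrow> 'e"
  assumes "linear B" "linear P"
  shows "bilinear (\<lambda>\<xi> \<zeta>. P \<xi> \<bullet> B (P \<zeta>))"
  unfolding bilinear_def
  by (auto intro!: linearI simp: linear_add[OF assms(1)] linear_add[OF assms(2)]
      linear_cmul[OF assms(1)] linear_cmul[OF assms(2)] inner_add_left inner_add_right)

lemma orthogonal_comp_image_decomposition:
  fixes B :: "'e::euclidean_space \<Rightarrow> 'e"
  assumes B: "symmetric_operator B" and pd: "pos_def_on T B" and T: "subspace T"
  shows "direct_decomposition T ((B ` T)\<^sup>\<bottom>)"
  unfolding direct_decomposition_def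
proof (intro conjI allI T subspace_orthogonal_comp)
  have lin: "linear B"
    using B by (simp add: symmetric_operator_def)
  show "T \<inter> (B ` T)\<^sup>\<bottom> = {0}"
  proof -
    have "t = 0" if "t \<in> T" "t \<in> (B ` T)\<^sup>\<bottom>" for t
      using that pd by (force simp: pos_def_on_def orthogonal_comp_def orthogonal_def inner_commute)
    then show ?thesis
      using subspace_0[OF T] subspace_0[OF subspace_orthogonal_comp] by blast
  qed
  fix \<xi>
  have "\<exists>!t. t \<in> T \<and> (\<forall>s\<in>T. s \<bullet> B t = s \<bullet> B \<xi>)"
    using bilinear_inner_operator[OF lin linear_ident] T pd
    by (intro bilinear_riesz_on[where \<phi> = "\<lambda>s. s \<bullet> B \<xi>"])
      (auto simp: pos_def_on_def inner_add_left intro: linearI)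
  then obtain t where t: "t \<in> T" "\<forall>s\<in>T. s \<bullet> B t = s \<bullet> B \<xi>" by blast
  have "B s \<bullet> (\<xi> - t) = 0" if "s \<in> T" for s
    using that t B by (simp add: symmetric_operator_def inner_diff_right)
  then have "\<xi> - t \<in> (B ` T)\<^sup>\<bottom>"
    by (auto simp: orthogonal_comp_def orthogonal_def)
  with t show "\<exists>t\<in>T. \<exists>n\<in>(B ` T)\<^sup>\<bottom>. \<xi> = t + n"
    by (metis add.commute diff_add_cancel)
qed

section \<open>Adjoint and pseudoinverse for a metric\<close>

lemma metric_adjoint_eq:
  fixes g :: "'e::euclidean_space \<Rightarrow> 'e \<Rightarrow> real" and A :: "'e \<Rightarrow> 'f::euclidean_space"
  assumes g: "inner_product_form g" and A: "linear A"
  shows "g \<xi> (metric_adjoint g A y) = A \<xi> \<bullet> y"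
proof -
  have "\<exists>!v. v \<in> UNIV \<and> (\<forall>\<xi>\<in>UNIV. g \<xi> v = A \<xi> \<bullet> y)" for y
    using g by (intro bilinear_riesz_on)
      (auto simp: inner_product_form_def linear_add[OF A] linear_cmul[OF A] inner_add_left
        intro: linearI)
  then have ex1: "\<exists>!v. \<forall>\<xi>. A \<xi> \<bullet> y = g \<xi> v" for y
    by (simp add: eq_commute)
  then obtain A' where A': "\<forall>\<xi> y. A \<xi> \<bullet> y = g \<xi> (A' y)"
    by metis
  \<comment> \<open>The description operator ranges over whole functions; uniqueness of the
    representer for each \<open>y\<close> gives uniqueness of the function by
    extensionality.\<close>
  have "\<forall>\<xi> y. A \<xi> \<bullet> y = g \<xi> (metric_adjoint g A y)"
    unfolding metric_adjoint_def
  proof (rule theI[of _ A'])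
    show "A'' = A'" if "\<forall>\<xi> y. A \<xi> \<bullet> y = g \<xi> (A'' y)" for A''
      using ex1 A' that by (intro ext) blast
  qed (fact A')
  then show ?thesis by simp
qed

lemma inner_product_form_eqI:
  assumes "inner_product_form g" "\<And>\<xi>. g \<xi> u = g \<xi> v"
  shows "u = v"
proof -
  have "g (u - v) (u - v) = 0"
    using assms(2) bilinear_rsub[of g "u - v" u v] assms(1)
    unfolding inner_product_form_def by (metis diff_self)
  then show ?thesis
    using assms(1) unfolding inner_product_form_def by (metis less_irrefl right_minus_eq)
qed

lemma linear_metric_adjoint:
  fixes g :: "'e::euclidean_space \<Rightarrow> 'e \<Rightarrow> real" and A :: "'e \<Rightarrow> 'f::euclidean_space"
  assumes g: "inner_product_form g" and A: "linear A"
  shows "linear (metric_adjoint g A)"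
proof -
  have bil: "bilinear g"
    using g by (simp add: inner_product_form_def)
  show ?thesis
    by (rule linearI; rule inner_product_form_eqI[OF g])
      (simp_all add: metric_adjoint_eq[OF g A] bilinear_radd[OF bil] bilinear_rmul[OF bil]
        inner_add_right)
qed

text \<open>If \<open>A (?A' y) = 0\<close>, then
  \<open>g (?A' y) (?A' y) = A (?A' y) \<bullet> y = 0\<close>, so \<open>?A' y = 0\<close> and
  \<open>y\<close> is orthogonal to the range of \<open>A\<close>, which is everything. Thus
  \<open>A \<circ> ?A'\<close> is an injective endomorphism in finite dimension, hence surjective,
  and \<open>inv\<close> is a genuine right inverse of it.\<close>

lemma metric_pinv_right_inverse:
  fixes g :: "'e::euclidean_space \<Rightarrow> 'e \<Rightarrow> real" and A :: "'e \<Rightarrow> 'f::euclidean_space"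
  assumes g: "inner_product_form g" and A: "linear A" and surj: "surj A"
  shows "A (metric_pinv g A y) = y"
proof -
  let ?A' = "metric_adjoint g A"
  have lin: "linear (A \<circ> ?A')"
    by (rule linear_compose[OF linear_metric_adjoint[OF g A] A])
  have "y = 0" if "(A \<circ> ?A') y = 0" for y
  proof -
    have "g (?A' y) (?A' y) = 0"
      using that by (simp add: metric_adjoint_eq[OF g A])
    then have "?A' y = 0"
      using g unfolding inner_product_form_def by (metis less_irrefl)
    then have "A \<xi> \<bullet> y = 0" for \<xi>
      using g bilinear_rzero[of g \<xi>]
      by (simp flip: metric_adjoint_eq[OF g A] add: inner_product_form_def)
    then show "y = 0"
      using surj by (metis inner_eq_zero_iff surjD)
  qed
  then have "surj (A \<circ> ?A')"
    using lin linear_injective_0 linear_injective_imp_surjective by blast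
  then show ?thesis
    unfolding metric_pinv_def by (metis comp_apply surj_f_inv_f)
qed

text \<open>Values of the pseudoinverse lie in the range of the adjoint. This keeps the feasibility
  correction from disturbing stationarity along the kernel.\<close>

lemma metric_pinv_orthogonal_kernel:
  assumes "inner_product_form g" "linear A" "A \<xi> = 0"
  shows "g \<xi> (metric_pinv g A y) = 0"
  using assms by (simp add: metric_pinv_def metric_adjoint_eq)

section \<open>Riemannian and Euclidean gradients\<close>

lemma riemannian_gradient_spec:
  assumes g: "inner_product_form g" and Dc: "linear (Diff c x)" and Df: "linear (Diff f x)"
  shows "riemannian_gradient g c f x \<in> tangent_space c x"
    and "\<xi> \<in> tangent_space c x \<Longrightarrow> g (riemannian_gradient g c f x) \<xi> = Diff f x \<xi>"
proof -
  have T: "subspace (tangent_space c x)"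
    unfolding tangent_space_def by (rule linear_subspace_kernel[OF Dc])
  have "\<exists>!v. v \<in> tangent_space c x \<and> (\<forall>\<xi>\<in>tangent_space c x. g \<xi> v = Diff f x \<xi>)"
    using g by (intro bilinear_riesz_on T Df) (auto simp: inner_product_form_def)
  \<comment> \<open>The Riesz lemma puts the representer in the second slot, the gradient in the
    first; symmetry of \<open>g\<close> reconciles them.\<close>
  moreover have "g \<xi> v = g v \<xi>" for \<xi> v
    using g by (simp add: inner_product_form_def)
  ultimately have
    "\<exists>!v. v \<in> tangent_space c x \<and> (\<forall>\<xi>\<in>tangent_space c x. g v \<xi> = Diff f x \<xi>)"
    by simp
  from theI'[OF this] show "riemannian_gradient g c f x \<in> tangent_space c x"
    and "\<xi> \<in> tangent_space c x \<Longrightarrow> g (riemannian_gradient g c f x) \<xi> = Diff f x \<xi>"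
    unfolding riemannian_gradient_def by blast+
qed

lemma cont_diff_imp_differentiable:
  assumes "cont_diff h"
  shows "h differentiable (at x)"
  using assms unfolding cont_diff_def differentiable_def by blast

lemma inner_euclidean_gradient:
  assumes "f differentiable (at x)"
  shows "\<xi> \<bullet> euclidean_gradient f x = Diff f x \<xi>"
proof -
  let ?D = "Diff f x"
  have D: "(f has_derivative ?D) (at x)"
    using assms by (simp add: frechet_derivative_works)
  \<comment> \<open>On the reals \<open>?D h\<close> equals \<open>?D h \<bullet> 1\<close>, so the
    adjoint applied to \<open>1\<close> is the gradient vector.\<close>
  have "?D = (\<lambda>h. h \<bullet> adjoint ?D 1)"
    using adjoint_works[OF has_derivative_linear[OF D]] by (simp add: fun_eq_iff)
  with D have "GDERIV f x :> adjoint ?D 1"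
    by (simp add: gderiv_def)
  moreover have "v = u" if "GDERIV f x :> v" "GDERIV f x :> u" for u v
    using has_derivative_unique[OF that[unfolded gderiv_def]]
    by (simp add: fun_eq_iff vector_eq_ldot)
  ultimately have "GDERIV f x :> euclidean_gradient f x"
    unfolding euclidean_gradient_def by (blast intro: theI)
  then have "?D = (\<lambda>h. h \<bullet> euclidean_gradient f x)"
    unfolding gderiv_def by (rule has_derivative_unique[OF D])
  then show ?thesis by (simp add: fun_eq_iff)
qed

section \<open>Strict convexity and the SQP direction\<close>

lemma is_sqp_direction_iff:
  fixes c :: "'e::euclidean_space \<Rightarrow> 'f::euclidean_space"
  assumes Dc: "linear (Diff c x)" and B: "symmetric_operator B"
    and pd: "pos_def_on (tangent_space c x) B"
    and feas: "Diff c x d\<^sub>0 + c x = 0"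
    and stat: "\<And>t. t \<in> tangent_space c x \<Longrightarrow> t \<bullet> euclidean_gradient f x + t \<bullet> B d\<^sub>0 = 0"
  shows "is_sqp_direction f c B x d \<longleftrightarrow> d = d\<^sub>0"
proof -
  let ?q = "\<lambda>d. f x + d \<bullet> euclidean_gradient f x + 1 / 2 * (d \<bullet> B d)"
  have lin: "linear B" and sym: "\<And>\<xi> \<zeta>. B \<xi> \<bullet> \<zeta> = \<xi> \<bullet> B \<zeta>"
    using B by (auto simp: symmetric_operator_def)
  have less: "?q d\<^sub>0 < ?q d" if d: "Diff c x d + c x = 0" and ne: "d \<noteq> d\<^sub>0" for d
  proof -
    define t where "t = d - d\<^sub>0"
    have "Diff c x t = 0"
      using d feas by (simp add: t_def linear_diff[OF Dc] eq_neg_iff_add_eq_0[symmetric])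
    then have t: "t \<in> tangent_space c x" by (simp add: tangent_space_def)
    have d_eq: "d = d\<^sub>0 + t" by (simp add: t_def)
    \<comment> \<open>The expansion of a quadratic about \<open>d\<^sub>0\<close> is exact. Its
      linear part vanishes by \<open>stat\<close>, leaving a curvature term that is positive since
      \<open>t\<close> is tangent and nonzero.\<close>
    have "?q d - ?q d\<^sub>0 = (t \<bullet> euclidean_gradient f x + t \<bullet> B d\<^sub>0) + 1 / 2 * (t \<bullet> B t)"
      using sym[of d\<^sub>0 t]
      by (simp add: d_eq linear_add[OF lin] inner_add_left inner_add_right inner_commute field_simps)
    moreover have "t \<bullet> B t > 0"
      using pd t ne by (simp add: pos_def_on_def t_def)
    ultimately show ?thesis using stat[OF t] by simp
  qed
  show ?thesis
    unfolding is_sqp_direction_def is_arg_min_def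
    using less feas by (metis less_asym)
qed

theorem proposition5p2:
  fixes f :: "'e::euclidean_space \<Rightarrow> real"
    and c :: "'e \<Rightarrow> 'f::euclidean_space"
    and x\<^sub>k :: 'e
    and B\<^sub>k :: "'e \<Rightarrow> 'e"
    and G\<^sub>N :: "'e \<Rightarrow> 'e \<Rightarrow> 'e"
  assumes "DIM('f) < DIM('e)"
    and "cont_diff f"
    and "cont_diff c"
    and "x\<^sub>k \<in> full_rank_set c"
    and "symmetric_operator B\<^sub>k"
    and "pos_def_on (tangent_space c x\<^sub>k) B\<^sub>k"
    and "symmetric_operator (G\<^sub>N x\<^sub>k)"
    and "pos_def_on (sqp_normal_space c B\<^sub>k x\<^sub>k) (G\<^sub>N x\<^sub>k)"
  shows
   "(direct_decomposition (tangent_space c x\<^sub>k) (sqp_normal_space c B\<^sub>k x\<^sub>k)) \<and>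
    (inner_product_form (sqp_metric c B\<^sub>k (G\<^sub>N x\<^sub>k) x\<^sub>k)) \<and>
    (\<forall>d. is_sqp_direction f c B\<^sub>k x\<^sub>k d \<longleftrightarrow>
           d = - riemannian_gradient (sqp_metric c B\<^sub>k (G\<^sub>N x\<^sub>k) x\<^sub>k) c f x\<^sub>k
               - metric_pinv (sqp_metric c B\<^sub>k (G\<^sub>N x\<^sub>k) x\<^sub>k) (Diff c x\<^sub>k) (c x\<^sub>k)) \<and>
    (\<forall>H. H x\<^sub>k = id \<longrightarrow>
           (\<forall>d. is_sqp_direction f c B\<^sub>k x\<^sub>k d \<longleftrightarrow>
             d = landing_direction (sqp_metric c B\<^sub>k (G\<^sub>N x\<^sub>k) x\<^sub>k) H c f x\<^sub>k)) \<and>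
    ({\<xi>. \<forall>\<zeta>\<in>tangent_space c x\<^sub>k. sqp_metric c B\<^sub>k (G\<^sub>N x\<^sub>k) x\<^sub>k \<xi> \<zeta> = 0}
           = sqp_normal_space c B\<^sub>k x\<^sub>k) \<and>
    (\<forall>\<xi>\<in>tangent_space c x\<^sub>k. \<forall>\<zeta>\<in>tangent_space c x\<^sub>k.
           sqp_metric c B\<^sub>k (G\<^sub>N x\<^sub>k) x\<^sub>k \<xi> \<zeta> = \<xi> \<bullet> B\<^sub>k \<zeta>)"
proof -
  let ?x = "x\<^sub>k"
  let ?T = "tangent_space c ?x"
  let ?N = "sqp_normal_space c B\<^sub>k ?x"
  let ?g = "sqp_metric c B\<^sub>k (G\<^sub>N ?x) ?x"
  let ?P = "sqp_proj c B\<^sub>k ?x"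
  let ?Q = "sqp_proj_perp c B\<^sub>k ?x"
  have diff_f: "f differentiable (at ?x)" and diff_c: "c differentiable (at ?x)"
    using assms(2,3) by (simp_all add: cont_diff_imp_differentiable)
  have Df: "linear (Diff f ?x)" and Dc: "linear (Diff c ?x)"
    using diff_f diff_c by (simp_all add: linear_frechet_derivative)
  \<comment> \<open>The range is a subspace of full dimension in the codomain, hence all of
    it.\<close>
  have surj: "surj (Diff c ?x)"
    using assms(4) linear_subspace_image[OF Dc subspace_UNIV]
    unfolding full_rank_set_def by (metis (mono_tags) dim_eq_full mem_Collect_eq span_eq_iff)
  have T: "subspace ?T"
    unfolding tangent_space_def by (rule linear_subspace_kernel[OF Dc])
  have B: "linear B\<^sub>k" "\<And>\<xi> \<zeta>. B\<^sub>k \<xi> \<bullet> \<zeta> = \<xi> \<bullet> B\<^sub>k \<zeta>"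
    and G: "linear (G\<^sub>N ?x)" "\<And>\<xi> \<zeta>. G\<^sub>N ?x \<xi> \<bullet> \<zeta> = \<xi> \<bullet> G\<^sub>N ?x \<zeta>"
    using assms(5,7) by (auto simp: symmetric_operator_def)
  have dec: "direct_decomposition ?T ?N"
    unfolding sqp_normal_space_def
    by (rule orthogonal_comp_image_decomposition[OF assms(5,6) T])
  have P_in: "?P \<xi> \<in> ?T" and Q_in: "?Q \<xi> \<in> ?N" for \<xi>
    using oblique_proj_mem[OF dec] by (auto simp: sqp_proj_def sqp_proj_perp_def)
  have lin_P: "linear ?P"
    unfolding sqp_proj_def by (rule linear_oblique_proj[OF dec])
  have lin_Q: "linear ?Q"
    unfolding sqp_proj_perp_def by (rule linear_compose_sub[OF linear_ident lin_P])
  have P_T: "?P \<xi> = \<xi>" and Q_T: "?Q \<xi> = 0" if "\<xi> \<in> ?T" for \<xi>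
    using oblique_proj_unique[OF dec that, of \<xi>] dec
    by (simp_all add: sqp_proj_def sqp_proj_perp_def direct_decomposition_def subspace_0)
  have N_iff: "\<xi> \<in> ?N \<longleftrightarrow> (\<forall>\<zeta>\<in>?T. \<xi> \<bullet> B\<^sub>k \<zeta> = 0)" for \<xi>
    by (auto simp: sqp_normal_space_def orthogonal_comp_def orthogonal_def inner_commute)
  \<comment> \<open>Only \<open>\<zeta>\<close> has to be tangent. The \<open>G\<^sub>N\<close> term
    drops since \<open>?Q \<zeta> = 0\<close>, and adding the zero term
    \<open>?Q \<xi> \<bullet> B\<^sub>k \<zeta>\<close> reassembles \<open>\<xi>\<close>. This one
    identity yields the tangent metric, the normal space and stationarity.\<close>
  have g_T: "?g \<xi> \<zeta> = \<xi> \<bullet> B\<^sub>k \<zeta>" if "\<zeta> \<in> ?T" for \<xi> \<zeta>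
  proof -
    have "?g \<xi> \<zeta> = ?P \<xi> \<bullet> B\<^sub>k \<zeta>"
      using that by (simp add: sqp_metric_def P_T Q_T linear_0[OF G(1)])
    also have "\<dots> = ?P \<xi> \<bullet> B\<^sub>k \<zeta> + ?Q \<xi> \<bullet> B\<^sub>k \<zeta>"
      using Q_in[of \<xi>] that by (simp add: N_iff)
    also have "\<dots> = \<xi> \<bullet> B\<^sub>k \<zeta>"
      by (simp add: sqp_proj_perp_def flip: inner_add_left)
    finally show ?thesis .
  qed
  have g: "inner_product_form ?g"
    unfolding inner_product_form_def
  proof (intro conjI allI impI)
    show "bilinear ?g"
      using bilinear_inner_operator[OF B(1) lin_P] bilinear_inner_operator[OF G(1) lin_Q]
      unfolding bilinear_def sqp_metric_def by (auto intro: linear_compose_add)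
    show "?g \<xi> \<zeta> = ?g \<zeta> \<xi>" for \<xi> \<zeta>
      unfolding sqp_metric_def using B(2) G(2) by (metis inner_commute)
    fix \<xi> :: 'e assume "\<xi> \<noteq> 0"
    \<comment> \<open>Since \<open>\<xi> = ?P \<xi> + ?Q \<xi>\<close>, one part is nonzero, and
      each operator is definite on the space containing its part.\<close>
    then have "?P \<xi> \<noteq> 0 \<or> ?Q \<xi> \<noteq> 0"
      by (auto simp: sqp_proj_perp_def)
    moreover have "?P \<xi> \<noteq> 0 \<Longrightarrow> ?P \<xi> \<bullet> B\<^sub>k (?P \<xi>) > 0" "?Q \<xi> \<noteq> 0 \<Longrightarrow> ?Q \<xi> \<bullet> G\<^sub>N ?x (?Q \<xi>) > 0"
      using assms(6,8) P_in Q_in by (auto simp: pos_def_on_def)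
    ultimately show "?g \<xi> \<xi> > 0"
      unfolding sqp_metric_def
      by (cases "?P \<xi> = 0"; cases "?Q \<xi> = 0") (auto intro: add_pos_pos)
  qed
  have g_N: "{\<xi>. \<forall>\<zeta>\<in>?T. ?g \<xi> \<zeta> = 0} = ?N"
    by (auto simp: N_iff g_T)
  let ?grad = "riemannian_gradient ?g c f ?x"
  let ?p = "metric_pinv ?g (Diff c ?x) (c ?x)"
  have grad_T: "?grad \<in> ?T"
    and grad_eq: "\<And>\<xi>. \<xi> \<in> ?T \<Longrightarrow> ?g ?grad \<xi> = Diff f ?x \<xi>"
    using riemannian_gradient_spec[OF g Dc Df] by blast+
  \<comment> \<open>The gradient is tangent and so is killed by \<open>Diff c ?x\<close>; the
    pseudoinverse term contributes exactly \<open>- c ?x\<close>.\<close>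
  have feas: "Diff c ?x (- ?grad - ?p) + c ?x = 0"
    using grad_T metric_pinv_right_inverse[OF g Dc surj]
    by (simp add: linear_diff[OF Dc] linear_neg[OF Dc] tangent_space_def)
  have stat: "t \<bullet> euclidean_gradient f ?x + t \<bullet> B\<^sub>k (- ?grad - ?p) = 0" if t: "t \<in> ?T" for t
  proof -
    have "?g ?p t = 0"
      using t g metric_pinv_orthogonal_kernel[OF g Dc, of t "c ?x"]
      by (simp add: tangent_space_def inner_product_form_def)
    \<comment> \<open>Against the tangent vector \<open>t\<close> the operator
      \<open>B\<^sub>k\<close> acts as the metric, even on the non-tangent vector \<open>?p\<close>.
      The gradient term then cancels the derivative of \<open>f\<close>.\<close>
    moreover have "t \<bullet> B\<^sub>k (- ?grad - ?p) = - ?g ?grad t - ?g ?p t"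
      using B(2)[of t ?grad] B(2)[of t ?p]
      by (simp add: g_T[OF t] linear_diff[OF B(1)] linear_neg[OF B(1)] inner_diff_right
          inner_commute)
    ultimately show ?thesis
      by (simp add: grad_eq[OF t] inner_euclidean_gradient[OF diff_f])
  qed
  have sqp: "is_sqp_direction f c B\<^sub>k ?x d \<longleftrightarrow> d = - ?grad - ?p" for d
    by (rule is_sqp_direction_iff) (fact Dc assms(5,6) feas stat)+
  show ?thesis
  proof (intro conjI)
    show "\<forall>H. H ?x = id \<longrightarrow>
        (\<forall>d. is_sqp_direction f c B\<^sub>k ?x d \<longleftrightarrow> d = landing_direction ?g H c f ?x)"
      by (simp add: sqp landing_direction_def)
    show "\<forall>\<xi>\<in>?T. \<forall>\<zeta>\<in>?T. ?g \<xi> \<zeta> = \<xi> \<bullet> B\<^sub>k \<zeta>"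
      using g_T by blast
  qed (rule dec g allI[OF sqp] g_N)+
qed

end
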